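(* Let $\mathcal{I}$, $\mathcal{K}$ be ideals on a set $S$ and let $X$ be a metric space which is not discrete (i.e. $X$ has at least one non-isolated point). Suppose that every $\mathcal{I}$-Cauchy function $f\colon S\to X$ is $\mathcal{I}^{\mathcal{K}}$-Cauchy. Then the condition $\mathrm{AP}(\mathcal{I},\mathcal{K})$ holds.
   Context: An ideal on a set $S$ is a nonempty family of subsets of $S$ closed under subsets and finite unions (it is not required to be proper or to contain the singletons). Its dual filter is $\mathcal{F}(\mathcal{I})=\{S\setminus A: A\in\mathcal{I}\}$. For $M\subseteq S$, $\mathcal{K}|_M=\{A\cap M: A\in\mathcal{K}\}$ is the trace ideal on $M$. For a metric space $(X,d)$ with its metric uniformity: a map $f\colon S\to X$ is $\mathcal{I}$-Cauchy if for every entourage $U$ (equivalently, for every $U=\{(x,y): d(x,y)<\varepsilon\}$, $\varepsilon>0$) there exists $m\in S$ such that $\{n\in S: (f(n),f(m))\notin U\}\in\mathcal{I}$. A map $f\colon S\to X$ is $\mathcal{I}^{\mathcal{K}}$-Cauchy if there is $M\in\mathcal{F}(\mathcal{I})$ such that $f|_M\colon M\to X$ is $\mathcal{K}|_M$-Cauchy. Condition $\mathrm{AP}(\mathcal{I},\mathcal{K})$: for every sequence $(A_n)_{n\in\mathbb{N}}$ of pairwise disjoint sets $A_n\in\mathcal{I}$ there exists a sequence $(B_n)_{n\in\mathbb{N}}$ of sets $B_n\in\mathcal{I}$ such that $A_n\triangle B_n\in\mathcal{K}$ for each $n$ and $\bigcup_{n\in\mathbb{N}}B_n\in\mathcal{I}$.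 *)

theory Defs
  imports "HOL-Analysis.Analysis"
begin

(* Ideals need not be proper and need not contain the singletons. *)
definition ideal_on :: "'a set \<Rightarrow> 'a set set \<Rightarrow> bool" where
  "ideal_on S I \<longleftrightarrow>
     I \<noteq> {} \<and> I \<subseteq> Pow S \<and>
     (\<forall>A\<in>I. \<forall>B. B \<subseteq> A \<longrightarrow> B \<in> I) \<and>
     (\<forall>A\<in>I. \<forall>B\<in>I. A \<union> B \<in> I)"

definition dual_filter :: "'a set \<Rightarrow> 'a set set \<Rightarrow> 'a set set" where
  "dual_filter S I = {S - A | A. A \<in> I}"

definition trace_ideal :: "'a set set \<Rightarrow> 'a set \<Rightarrow> 'a set set" where
  "trace_ideal K M = {A \<inter> M | A. A \<in> K}"

(* A map S \<rightarrow> X is a total function of which only the values on S are used, so the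
   restriction of f to M is expressed by passing M as the domain.  Entourages are the
   sets U that hold eventually in the library's uniformity filter. *)
definition ideal_Cauchy :: "'a set \<Rightarrow> 'a set set \<Rightarrow> ('a \<Rightarrow> 'b::uniform_space) \<Rightarrow> bool" where
  "ideal_Cauchy S I f \<longleftrightarrow>
     (\<forall>U. (\<forall>\<^sub>F p in uniformity. p \<in> U) \<longrightarrow>
        (\<exists>m\<in>S. {n \<in> S. (f n, f m) \<notin> U} \<in> I))"

definition ideal_Cauchy_mod ::
    "'a set \<Rightarrow> 'a set set \<Rightarrow> 'a set set \<Rightarrow> ('a \<Rightarrow> 'b::uniform_space) \<Rightarrow> bool" where
  "ideal_Cauchy_mod S I K f \<longleftrightarrow>
     (\<exists>M\<in>dual_filter S I. ideal_Cauchy M (trace_ideal K M) f)"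

definition AP :: "'a set set \<Rightarrow> 'a set set \<Rightarrow> bool" where
  "AP I K \<longleftrightarrow>
     (\<forall>A :: nat \<Rightarrow> 'a set. (\<forall>n. A n \<in> I) \<and> disjoint_family A \<longrightarrow>
        (\<exists>B :: nat \<Rightarrow> 'a set. (\<forall>n. B n \<in> I) \<and> (\<forall>n. sym_diff (A n) (B n) \<in> K) \<and>
           (\<Union>n. B n) \<in> I))"

end

theory Submission
  imports Defs
begin

text \<open>
  A non-isolated point \<open>p\<close> is the limit of an injective sequence \<open>x\<close>.
  A disjoint sequence \<open>A\<close> in \<open>I\<close> is encoded by the function that is constantly \<open>x n\<close> on \<open>A n\<close> and
  is \<open>p\<close> elsewhere.

  If \<open>S\<close> is empty, all \<open>A n\<close> are empty and \<open>B = A\<close> works. Otherwise, since the function is close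
  to \<open>p\<close> outside finitely many of the \<open>A n\<close>, it is \<open>I\<close>-Cauchy (\<open>ideal_Cauchy_if_near_point\<close>).
  By hypothesis there is then \<open>C \<in> I\<close> such that the function is \<open>K\<close>-Cauchy on \<open>S - C\<close>. Two level sets of a Cauchy function cannot both be large:
  the values are at positive distance, so no single point is close to both
  (\<open>ideal_Cauchy_level_sets\<close>). Hence \<open>A n - C \<in> K\<close> for all \<open>n\<close> with at most one exception. Put
  \<open>B n = A n \<inter> C\<close>, except that \<open>B n = A n\<close> for the exceptional index, if it exists. Then
  \<open>A n\<close> and \<open>B n\<close> differ by a set in \<open>K\<close>, and the union of the \<open>B n\<close> is covered by \<open>C\<close> and at most
  one of the \<open>A n\<close>, so it belongs to \<open>I\<close>.
\<close>

lemma ideal_on_empty: "ideal_on S I \<Longrightarrow> {} \<in> I"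
  unfolding ideal_on_def by blast

lemma ideal_on_subset: "ideal_on S I \<Longrightarrow> A \<in> I \<Longrightarrow> B \<subseteq> A \<Longrightarrow> B \<in> I"
  unfolding ideal_on_def by blast

lemma ideal_on_Un: "ideal_on S I \<Longrightarrow> A \<in> I \<Longrightarrow> B \<in> I \<Longrightarrow> A \<union> B \<in> I"
  unfolding ideal_on_def by blast

lemma ideal_on_carrier: "ideal_on S I \<Longrightarrow> A \<in> I \<Longrightarrow> A \<subseteq> S"
  unfolding ideal_on_def by auto

lemma ideal_on_finite_UN:
  assumes "ideal_on S I" "finite N" "\<And>n. n \<in> N \<Longrightarrow> A n \<in> I"
  shows "(\<Union>n\<in>N. A n) \<in> I"
  using assms(2,3)
  by (induction N) (simp_all add: ideal_on_empty[OF assms(1)] ideal_on_Un[OF assms(1)])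

lemma trace_ideal_subset:
  assumes "ideal_on S K"
  shows "trace_ideal K M \<subseteq> K"
  unfolding trace_ideal_def by (auto intro: ideal_on_subset[OF assms _ Int_lower1])

lemma not_discrete_imp_inj_sequence:
  assumes "\<not> discrete (UNIV :: 'b::metric_space set)"
  obtains p :: "'b::metric_space" and x :: "nat \<Rightarrow> 'b::metric_space" where "inj x" "x \<longlonglongrightarrow> p"
proof -
  obtain p :: 'b where "p islimpt UNIV"
    using assms by (auto simp: discrete_def isolated_in_islimpt_iff)
  then show thesis
    using that unfolding limpt_sequential_inj by blast
qed

text \<open>
  An ideal-convergent function is ideal-Cauchy, but the Cauchy condition asks for a comparison point
  \<open>m\<close> in \<open>S\<close>, whereas \<open>p\<close> need not be a value of \<open>f\<close>. A point outside the exceptional set serves as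
  \<open>m\<close>; if there is none, the whole of \<open>S\<close> lies in the ideal and any point serves. This is where \<open>S\<close>
  has to be nonempty.
\<close>

lemma ideal_Cauchy_if_near_point:
  fixes f :: "'a \<Rightarrow> 'b::metric_space"
  assumes I: "ideal_on S I" and "S \<noteq> {}"
    and near: "\<And>e. e > 0 \<Longrightarrow> {s \<in> S. dist (f s) p \<ge> e} \<in> I"
  shows "ideal_Cauchy S I f"
  unfolding ideal_Cauchy_def
proof (intro allI impI)
  fix U :: "('b \<times> 'b) set"
  assume "\<forall>\<^sub>F q in uniformity. q \<in> U"
  then obtain e where "e > 0" and e: "\<And>x y. dist x y < e \<Longrightarrow> (x, y) \<in> U"
    unfolding eventually_uniformity_metric by auto
  define R where "R = {s \<in> S. dist (f s) p \<ge> e / 2}"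
  have "R \<in> I"
    using near[of "e / 2"] \<open>e > 0\<close> unfolding R_def by simp
  show "\<exists>m\<in>S. {n \<in> S. (f n, f m) \<notin> U} \<in> I"
  proof (cases "S \<subseteq> R")
    case True
    have "{n \<in> S. (f n, f m) \<notin> U} \<in> I" for m
      by (rule ideal_on_subset[OF I \<open>R \<in> I\<close>]) (use True in blast)
    then show ?thesis
      using \<open>S \<noteq> {}\<close> by blast
  next
    case False
    then obtain m where m: "m \<in> S" "m \<notin> R"
      by blast
    have "(f n, f m) \<in> U" if "n \<in> S" "n \<notin> R" for n
    proof (rule e)
      show "dist (f n) (f m) < e"
        by (rule dist_triangle_half_l[of _ p]) (use that m in \<open>simp_all add: R_def\<close>)
    qed
    then have "{n \<in> S. (f n, f m) \<notin> U} \<subseteq> R"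
      by blast
    then have "{n \<in> S. (f n, f m) \<notin> U} \<in> I"
      by (rule ideal_on_subset[OF I \<open>R \<in> I\<close>])
    then show ?thesis
      using m(1) by (rule bexI)
  qed
qed

text \<open>
  The reason is the triangle inequality: the value \<open>f m\<close> at a comparison point has distance at least
  half of \<open>dist a b\<close> from \<open>a\<close> or from \<open>b\<close>.
\<close>

lemma ideal_Cauchy_level_sets:
  fixes f :: "'a \<Rightarrow> 'b::metric_space"
  assumes "ideal_Cauchy M J f" and "a \<noteq> b"
  obtains Z where "Z \<in> J" "{s \<in> M. f s = a} \<subseteq> Z \<or> {s \<in> M. f s = b} \<subseteq> Z"
proof -
  define U where "U = {(x :: 'b, y). dist x y < dist a b / 2}"
  have "\<forall>\<^sub>F q in uniformity. q \<in> U"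
    unfolding eventually_uniformity_metric U_def
    using \<open>a \<noteq> b\<close> by (intro exI[of _ "dist a b / 2"]) auto
  then obtain m where m: "{n \<in> M. (f n, f m) \<notin> U} \<in> J"
    using assms(1) unfolding ideal_Cauchy_def by blast
  have "(a, f m) \<notin> U \<or> (b, f m) \<notin> U"
    using dist_triangle_half_l[of a "f m" "dist a b" b] unfolding U_def by auto
  then show thesis
    using that[OF m] by blast
qed

lemma disjoint_family_step_function:
  assumes "disjoint_family A"
  shows "\<exists>f. (\<forall>n. \<forall>s\<in>A n. f s = x n) \<and> (\<forall>s. s \<notin> (\<Union>n. A n) \<longrightarrow> f s = p)"
proof -
  define f where "f s = (if s \<in> (\<Union>n. A n) then x (SOME n. s \<in> A n) else p)" for s
  have "f s = x n" if "s \<in> A n" for n s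
  proof -
    have "s \<in> A (SOME n. s \<in> A n)"
      using that by (rule someI)
    then have "(SOME n. s \<in> A n) = n"
      using assms that by (auto simp: disjoint_family_on_def)
    then show ?thesis
      using that by (auto simp: f_def)
  qed
  then show ?thesis
    by (intro exI[of _ f]) (simp add: f_def)
qed

theorem theorem5p2:
  fixes S :: "'a set" and I K :: "'a set set"
  assumes "ideal_on S I" and "ideal_on S K"
    and "\<not> discrete (UNIV :: 'b::metric_space set)"
    and "\<And>f :: 'a \<Rightarrow> 'b. ideal_Cauchy S I f \<Longrightarrow> ideal_Cauchy_mod S I K f"
  shows "AP I K"
  unfolding AP_def
proof (intro allI impI)
  note I = assms(1) and K = assms(2)
  fix A :: "nat \<Rightarrow> 'a set"
  assume "(\<forall>n. A n \<in> I) \<and> disjoint_family A"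
  then have A: "\<And>n. A n \<in> I" and disj: "disjoint_family A"
    by auto
  show "\<exists>B :: nat \<Rightarrow> 'a set. (\<forall>n. B n \<in> I) \<and> (\<forall>n. sym_diff (A n) (B n) \<in> K) \<and> (\<Union>n. B n) \<in> I"
  proof (cases "S = {}")
    case True
    then have "A n = {}" for n
      using ideal_on_carrier[OF I A[of n]] by simp
    then show ?thesis
      using ideal_on_empty[OF I] ideal_on_empty[OF K] by (intro exI[of _ A]) auto
  next
    case False
    obtain p :: 'b and x where "inj x" and lim: "x \<longlonglongrightarrow> p"
      using not_discrete_imp_inj_sequence[OF assms(3)] by blast
    obtain f where f: "\<And>n s. s \<in> A n \<Longrightarrow> f s = x n" "\<And>s. s \<notin> (\<Union>n. A n) \<Longrightarrow> f s = p"
      using disjoint_family_step_function[OF disj, of x p] by blast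
    have "ideal_Cauchy S I f"
    proof (rule ideal_Cauchy_if_near_point[OF I False])
      fix e :: real
      assume "e > 0"
      then obtain N where N: "\<And>n. n \<ge> N \<Longrightarrow> dist (x n) p < e"
        using lim unfolding lim_sequentially by blast
      have "{s \<in> S. dist (f s) p \<ge> e} \<subseteq> (\<Union>n\<in>{..<N}. A n)"
      proof
        fix s
        assume "s \<in> {s \<in> S. dist (f s) p \<ge> e}"
        then have far: "dist (f s) p \<ge> e"
          by simp
        then obtain n where n: "s \<in> A n"
          using f(2)[of s] \<open>e > 0\<close> by fastforce
        then have "n < N"
          using far f(1)[OF n] N[of n] by (metis not_le)
        then show "s \<in> (\<Union>n\<in>{..<N}. A n)"
          using n by blast
      qed
      moreover have "(\<Union>n\<in>{..<N}. A n) \<in> I"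
        using A by (intro ideal_on_finite_UN[OF I]) auto
      ultimately show "{s \<in> S. dist (f s) p \<ge> e} \<in> I"
        by (rule ideal_on_subset[OF I, rotated])
    qed
    then obtain C where C: "C \<in> I" and "ideal_Cauchy (S - C) (trace_ideal K (S - C)) f"
      using assms(4)[of f] unfolding ideal_Cauchy_mod_def dual_filter_def by auto
    note cauchy = this(2)
    have exception_unique: "i = j" if "A i - C \<notin> K" "A j - C \<notin> K" for i j
    proof (rule ccontr)
      assume "i \<noteq> j"
      then have "x i \<noteq> x j"
        using \<open>inj x\<close> by (simp add: inj_eq)
      then obtain Z where "Z \<in> trace_ideal K (S - C)"
        and Z: "{s \<in> S - C. f s = x i} \<subseteq> Z \<or> {s \<in> S - C. f s = x j} \<subseteq> Z"
        by (rule ideal_Cauchy_level_sets[OF cauchy])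
      then have "Z \<in> K"
        using trace_ideal_subset[OF K, of "S - C"] by auto
      have "A n - C \<subseteq> {s \<in> S - C. f s = x n}" for n
        using f(1)[of _ n] ideal_on_carrier[OF I A[of n]] by auto
      then have "A i - C \<subseteq> Z \<or> A j - C \<subseteq> Z"
        using Z subset_trans by meson
      then show False
        using that ideal_on_subset[OF K \<open>Z \<in> K\<close>] by auto
    qed
    define B where "B n = (if A n - C \<in> K then A n \<inter> C else A n)" for n
    have "B n \<in> I" for n
      by (rule ideal_on_subset[OF I A[of n]]) (auto simp: B_def)
    moreover have "sym_diff (A n) (B n) \<in> K" for n
    proof -
      have "sym_diff (A n) (A n \<inter> C) = A n - C"
        by blast
      then show ?thesis
        using ideal_on_empty[OF K] by (simp add: B_def)
    qed
    moreover have "(\<Union>n. B n) \<in> I"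
    proof (cases "\<exists>k. A k - C \<notin> K")
      case True
      then obtain k where "A k - C \<notin> K"
        by blast
      then have "B n \<subseteq> C \<union> A k" for n
        using exception_unique[of n k] by (auto simp: B_def)
      then show ?thesis
        by (intro ideal_on_subset[OF I ideal_on_Un[OF I C A[of k]]] UN_least)
    next
      case False
      then have "(\<Union>n. B n) \<subseteq> C"
        by (auto simp: B_def)
      then show ?thesis
        by (rule ideal_on_subset[OF I C])
    qed
    ultimately show ?thesis
      by (intro exI[of _ B]) simp
  qed
qed

end
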